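(* Let $\mu\le\lambda$ be integer partitions and consider the interval $[\mu,\lambda]$ in Young's lattice. Let $n$ be the smallest integer such that $\mu\le\delta_n$. If $\delta_{n+1}\le\lambda$, then the lattice $[\mu,\lambda]$ is an Eeta win if and only if $\mathrm{path}(\lambda)$ does not contain an odd-length block of east steps immediately followed by an odd-length block of north steps.
   Context: Young's lattice is the lattice of integer partitions ordered by containment of Young diagrams. The staircase is $\delta_n=(n,n-1,\dots,1)$ for $n\ge 0$ ($\delta_0=\emptyset$). A lattice path is a finite word in $\mathrm{N}$ (unit north step) and $\mathrm{E}$ (unit east step); a block is a maximal consecutive string of equal steps. For $\lambda=(\lambda_1,\dots,\lambda_k)$ with $\lambda_1\ge\cdots\ge\lambda_k\ge1$, $\mathrm{path}(\lambda)=\mathrm{E}^{\lambda_k}\mathrm{N}\mathrm{E}^{\lambda_{k-1}-\lambda_k}\mathrm{N}\cdots\mathrm{E}^{\lambda_1-\lambda_2}\mathrm{N}$ (the southeast boundary of $\lambda$). Ungar game: for a finite lattice $L$ and $x\in L$, an Ungar move sends $x$ to $\bigwedge(\{x\}\cup T)$ with $T$ a subset of the elements covered by $x$; it is nontrivial if $T\ne\emptyset$. Starting at the top element $\hat1$, Atniss (first) and Eeta alternately make nontrivial Ungar moves; the player who cannot move (i.e. faces $\hat0$) loses. $L$ is an Atniss win if Atniss has a winning strategy, otherwise an Eeta win. *)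

theory Defs
  imports "HOL-Algebra.Lattice"
begin

section \<open>Young's lattice\<close>

definition is_partition :: "nat list \<Rightarrow> bool" where
  "is_partition lam \<longleftrightarrow> sorted_wrt (\<ge>) lam \<and> 0 \<notin> set lam"

definition young_diagram :: "nat list \<Rightarrow> (nat \<times> nat) set" where
  "young_diagram lam = {(i, j). i < length lam \<and> j < lam ! i}"

definition young_le :: "nat list \<Rightarrow> nat list \<Rightarrow> bool" (infix \<open>\<le>\<^sub>Y\<close> 50) where
  "\<mu> \<le>\<^sub>Y \<nu> \<longleftrightarrow> young_diagram \<mu> \<subseteq> young_diagram \<nu>"

definition young_interval :: "nat list \<Rightarrow> nat list \<Rightarrow> nat list gorder" where
  "young_interval \<mu> lam =
     \<lparr>carrier = {\<nu>. is_partition \<nu> \<and> \<mu> \<le>\<^sub>Y \<nu> \<and> \<nu> \<le>\<^sub>Y lam}, eq = (=), le = (\<le>\<^sub>Y)\<rparr>"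

definition staircase :: "nat \<Rightarrow> nat list" where
  "staircase n = rev [1..<Suc n]"

section \<open>Lattice paths\<close>

datatype step = North | East

fun boundary_path :: "nat list \<Rightarrow> step list" where
  "boundary_path [] = []"
| "boundary_path [a] = replicate a East @ [North]"
| "boundary_path (a # b # bs) = boundary_path (b # bs) @ replicate (a - b) East @ [North]"

text \<open>\<open>is_block us s m vs\<close>: in the word \<open>us @ replicate m s @ vs\<close>, the displayed middle
  factor is a block, that is, a maximal nonempty run of the letter \<open>s\<close>.\<close>

definition is_block :: "step list \<Rightarrow> step \<Rightarrow> nat \<Rightarrow> step list \<Rightarrow> bool" where
  "is_block us s m vs \<longleftrightarrow>
     m > 0 \<and> (us = [] \<or> last us \<noteq> s) \<and> (vs = [] \<or> hd vs \<noteq> s)"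

definition has_odd_east_odd_north :: "step list \<Rightarrow> bool" where
  "has_odd_east_odd_north w \<longleftrightarrow>
     (\<exists>us a b vs. w = us @ replicate a East @ replicate b North @ vs \<and>
        is_block us East a (replicate b North @ vs) \<and>
        is_block (us @ replicate a East) North b vs \<and>
        odd a \<and> odd b)"

section \<open>The Ungar game\<close>

definition covered_by :: "('a, 'b) gorder_scheme \<Rightarrow> 'a \<Rightarrow> 'a set" where
  "covered_by L x =
     {y \<in> carrier L. y \<sqsubset>\<^bsub>L\<^esub> x \<and> \<not> (\<exists>z \<in> carrier L. y \<sqsubset>\<^bsub>L\<^esub> z \<and> z \<sqsubset>\<^bsub>L\<^esub> x)}"

definition nontrivial_ungar_move :: "('a, 'b) gorder_scheme \<Rightarrow> 'a \<Rightarrow> 'a \<Rightarrow> bool" where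
  "nontrivial_ungar_move L x y \<longleftrightarrow>
     (\<exists>T. T \<subseteq> covered_by L x \<and> T \<noteq> {} \<and> y = \<Sqinter>\<^bsub>L\<^esub> ({x} \<union> T))"

text \<open>A (partial) play is the list of positions reached so far, starting with the top element.
  Atniss is to move exactly when this list has odd length.\<close>

definition ungar_play :: "('a, 'b) gorder_scheme \<Rightarrow> 'a list \<Rightarrow> bool" where
  "ungar_play L xs \<longleftrightarrow>
     xs \<noteq> [] \<and> hd xs = \<top>\<^bsub>L\<^esub> \<and> successively (nontrivial_ungar_move L) xs"

definition ungar_stuck :: "('a, 'b) gorder_scheme \<Rightarrow> 'a \<Rightarrow> bool" where
  "ungar_stuck L x \<longleftrightarrow> \<not> (\<exists>y. nontrivial_ungar_move L x y)"

definition atniss_follows :: "('a list \<Rightarrow> 'a) \<Rightarrow> 'a list \<Rightarrow> bool" where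
  "atniss_follows \<sigma> xs \<longleftrightarrow>
     (\<forall>i. Suc i < length xs \<and> odd (Suc i) \<longrightarrow> xs ! Suc i = \<sigma> (take (Suc i) xs))"

definition atniss_strategy :: "('a, 'b) gorder_scheme \<Rightarrow> ('a list \<Rightarrow> 'a) \<Rightarrow> bool" where
  "atniss_strategy L \<sigma> \<longleftrightarrow>
     (\<forall>xs. ungar_play L xs \<and> atniss_follows \<sigma> xs \<and> odd (length xs) \<and>
        \<not> ungar_stuck L (last xs) \<longrightarrow> nontrivial_ungar_move L (last xs) (\<sigma> xs))"

text \<open>Plays in a finite lattice terminate, since nontrivial moves strictly descend. Hence a strategy
  wins iff every completed play following it leaves Eeta (even length) without a move.\<close>

definition atniss_win :: "('a, 'b) gorder_scheme \<Rightarrow> bool" where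
  "atniss_win L \<longleftrightarrow>
     (\<exists>\<sigma>. atniss_strategy L \<sigma> \<and>
        (\<forall>xs. ungar_play L xs \<and> atniss_follows \<sigma> xs \<and> ungar_stuck L (last xs) \<longrightarrow>
           even (length xs)))"

definition eeta_win :: "('a, 'b) gorder_scheme \<Rightarrow> bool" where
  "eeta_win L \<longleftrightarrow> \<not> atniss_win L"

section \<open>Intervals of Young's lattice are finite lattices\<close>

definition row :: "nat list \<Rightarrow> nat \<Rightarrow> nat" where
  "row lam i = (if i < length lam then lam ! i else 0)"

lemma young_diagram_row: "young_diagram lam = {(i, j). j < row lam i}"
  by (auto simp: young_diagram_def row_def split: if_splits)

lemma young_le_row: "\<mu> \<le>\<^sub>Y \<nu> \<longleftrightarrow> (\<forall>i. row \<mu> i \<le> row \<nu> i)"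
proof
  assume *: "\<mu> \<le>\<^sub>Y \<nu>"
  show "\<forall>i. row \<mu> i \<le> row \<nu> i"
  proof (rule allI, rule ccontr)
    fix i assume "\<not> row \<mu> i \<le> row \<nu> i"
    then have "(i, row \<nu> i) \<in> young_diagram \<mu>" by (simp add: young_diagram_row)
    with * show False by (auto simp: young_le_def young_diagram_row)
  qed
qed (auto simp: young_le_def young_diagram_row intro: less_le_trans)

lemma row_pos_iff: "is_partition lam \<Longrightarrow> 0 < row lam i \<longleftrightarrow> i < length lam"
  by (metis is_partition_def not_gr_zero nth_mem row_def)

lemma row_antimono: "is_partition lam \<Longrightarrow> i \<le> j \<Longrightarrow> row lam j \<le> row lam i"
  by (auto simp: is_partition_def row_def sorted_wrt_iff_nth_less le_less)

lemma partition_eqI: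
  assumes "is_partition \<mu>" "is_partition \<nu>" "\<And>i. row \<mu> i = row \<nu> i"
  shows "\<mu> = \<nu>"
proof (rule nth_equalityI)
  show len: "length \<mu> = length \<nu>"
    using assms row_pos_iff by (metis linorder_neqE_nat less_irrefl)
  show "\<mu> ! i = \<nu> ! i" if "i < length \<mu>" for i
    using assms(3)[of i] that len by (simp add: row_def)
qed

lemma partition_of_rows:
  assumes anti: "\<And>i j. i \<le> j \<Longrightarrow> f j \<le> f i" and zero: "f k = (0::nat)"
  obtains \<nu> where "is_partition \<nu>" "\<And>i. row \<nu> i = f i"
proof
  define m where "m = (LEAST k. f k = 0)"
  have m: "f m = 0" unfolding m_def using zero by (rule LeastI)
  have pos: "i < m \<Longrightarrow> 0 < f i" for i unfolding m_def using not_less_Least by blast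
  show "is_partition (map f [0..<m])"
    using anti pos by (fastforce simp: is_partition_def sorted_wrt_iff_nth_less)
  show "row (map f [0..<m]) i = f i" for i
    using anti[of m i] m by (simp add: row_def)
qed

lemma young_interval_lattice:
  "lattice (young_interval \<mu> lam)"
proof -
  let ?L = "young_interval \<mu> lam"
  have antisym: "x = y" if "is_partition x" "is_partition y" "x \<le>\<^sub>Y y" "y \<le>\<^sub>Y x" for x y
    using that by (intro partition_eqI antisym) (auto simp: young_le_row)
  have po: "partial_order ?L"
    by unfold_locales (auto simp: young_interval_def young_le_def intro: antisym[unfolded young_le_def])
  have sup: "\<exists>s. least ?L s (Upper ?L {x, y})"
    if "x \<in> carrier ?L" "y \<in> carrier ?L" for x y
  proof -
    from that have p: "is_partition x" "is_partition y" by (auto simp: young_interval_def)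
    obtain \<nu> where \<nu>: "is_partition \<nu>" "\<And>i. row \<nu> i = max (row x i) (row y i)"
    proof (rule partition_of_rows)
      show "max (row x j) (row y j) \<le> max (row x i) (row y i)" if "i \<le> j" for i j
        using row_antimono[OF p(1) that] row_antimono[OF p(2) that] by linarith
      show "max (row x (length x + length y)) (row y (length x + length y)) = 0"
        by (simp add: row_def)
    qed blast
    have "least ?L \<nu> (Upper ?L {x, y})"
      using that \<nu> by (auto simp: least_def Upper_def young_interval_def young_le_row le_max_iff_disj)
    then show ?thesis ..
  qed
  have inf: "\<exists>s. greatest ?L s (Lower ?L {x, y})"
    if "x \<in> carrier ?L" "y \<in> carrier ?L" for x y
  proof -
    from that have p: "is_partition x" "is_partition y" by (auto simp: young_interval_def)
    obtain \<nu> where \<nu>: "is_partition \<nu>" "\<And>i. row \<nu> i = min (row x i) (row y i)"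
    proof (rule partition_of_rows)
      show "min (row x j) (row y j) \<le> min (row x i) (row y i)" if "i \<le> j" for i j
        using row_antimono[OF p(1) that] row_antimono[OF p(2) that] by linarith
      show "min (row x (length x)) (row y (length x)) = 0"
        by (simp add: row_def)
    qed blast
    have "greatest ?L \<nu> (Lower ?L {x, y})"
      using that \<nu>
      by (auto simp: greatest_def Lower_def young_interval_def young_le_row min_le_iff_disj)
    then show ?thesis ..
  qed
  interpret partial_order ?L by (rule po)
  show ?thesis by unfold_locales (fact sup inf)+
qed

lemma finite_young_interval: "finite (carrier (young_interval \<mu> lam))"
proof (rule finite_subset)
  show "carrier (young_interval \<mu> lam) \<subseteq>
      {\<nu>. set \<nu> \<subseteq> {..sum_list lam} \<and> length \<nu> \<le> length lam}"
  proof
    fix \<nu> assume "\<nu> \<in> carrier (young_interval \<mu> lam)"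
    then have p: "is_partition \<nu>" and le: "\<And>i. row \<nu> i \<le> row lam i"
      by (auto simp: young_interval_def young_le_row)
    have "length \<nu> \<le> length lam"
      using row_pos_iff[OF p, of "length lam"] le[of "length lam"] by (simp add: row_def)
    moreover have "\<nu> ! i \<le> sum_list lam" if "i < length \<nu>" for i
      using le[of i] that calculation elem_le_sum_list[of i lam] by (simp add: row_def)
    ultimately show "\<nu> \<in> {\<nu>. set \<nu> \<subseteq> {..sum_list lam} \<and> length \<nu> \<le> length lam}"
      by (auto simp: in_set_conv_nth)
  qed
qed (rule finite_lists_length_le, simp)

end

theory Submission
  imports Defs
begin

text \<open>
  Regard a partition \<open>\<nu>\<close> between \<open>\<mu>\<close> and \<open>\<lambda>\<close> as a lattice path; an Ungar move flips a nonempty set of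
  peaks EN into NE, where only peaks whose cell lies outside \<open>\<mu>\<close> may be flipped. Delete from the path
  of \<open>\<nu>\<close> all steps shared with the path of \<open>\<mu>\<close>. For arbitrary \<open>\<mu> \<le> \<lambda>\<close>, the player to move loses iff
  the remaining path has no odd run of E followed by an odd run of N. Indeed, if there is no such pair,
  take a flipped peak with an even E-run, leftmost in its chain of merging runs: the run loses one E and
  is followed by a single N, so an odd pair appears (the case of an even N-run is the mirror image).
  Conversely, a set of flips that destroys all odd pairs is found by scanning the path from the left,
  keeping solutions for both possible parities of the N-run arriving from the right.
  The staircase hypothesis ensures that the paths of \<open>\<lambda>\<close> and \<open>\<mu>\<close> share no step.
\<close>

section \<open>Flipping peaks\<close>

text \<open>A path of length \<open>M\<close> has vertices \<open>0, \<dots>, M\<close>; step \<open>t\<close> joins \<open>t\<close> to \<open>t + 1\<close> and is East iff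
  \<open>e t\<close>. A step is shared with the lower path iff its upper end (the last vertex of an East step, the
  first vertex of a North step) is not free, i.e. lies on that path.\<close>

primrec odd_east_run :: "(nat \<Rightarrow> bool) \<Rightarrow> (nat \<Rightarrow> bool) \<Rightarrow> nat \<Rightarrow> bool" where
  "odd_east_run e fr 0 \<longleftrightarrow> False"
| "odd_east_run e fr (Suc t) \<longleftrightarrow> e t \<and> fr (Suc t) \<and> \<not> odd_east_run e fr t"

text \<open>The mirror image of the previous notion, so that statements about North runs follow by reflection.\<close>

definition odd_north_run :: "nat \<Rightarrow> (nat \<Rightarrow> bool) \<Rightarrow> (nat \<Rightarrow> bool) \<Rightarrow> nat \<Rightarrow> bool" where
  "odd_north_run M e fr t \<longleftrightarrow>
     odd_east_run (\<lambda>s. \<not> e (M - Suc s)) (\<lambda>s. fr (M - s)) (M - t)"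

text \<open>Odd runs are nonempty, so such a \<open>t\<close> is itself a free peak: the step before
  it is a free East step and the step after it a free North step.\<close>

definition odd_odd_peak :: "nat \<Rightarrow> (nat \<Rightarrow> bool) \<Rightarrow> (nat \<Rightarrow> bool) \<Rightarrow> bool" where
  "odd_odd_peak M e fr \<longleftrightarrow> (\<exists>t\<le>M. odd_east_run e fr t \<and> odd_north_run M e fr t)"

definition free_peaks :: "(nat \<Rightarrow> bool) \<Rightarrow> (nat \<Rightarrow> bool) \<Rightarrow> nat set" where
  "free_peaks e fr = {t. 0 < t \<and> e (t - 1) \<and> \<not> e t \<and> fr t}"

text \<open>Flipping the peak at vertex \<open>t\<close> swaps steps \<open>t - 1\<close> and
  \<open>t\<close>; hence step \<open>t\<close> reacts to \<open>Suc t\<close>, where it is the East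
  half, and to \<open>t\<close>, where it is the North half.\<close>

definition flip :: "(nat \<Rightarrow> bool) \<Rightarrow> nat set \<Rightarrow> nat \<Rightarrow> bool" where
  "flip e T t \<longleftrightarrow> Suc t \<notin> T \<and> (t \<in> T \<or> e t)"

text \<open>\<open>fr'\<close> is left open on \<open>T\<close>, since a flipped vertex may land on
  the lower path. Its value there is never consulted: after the flip a North step ends at that
  vertex and an East step leaves it, and their upper ends are other vertices.\<close>

definition flips_to :: "nat \<Rightarrow> (nat \<Rightarrow> bool) \<Rightarrow> (nat \<Rightarrow> bool) \<Rightarrow> nat set \<Rightarrow>
    (nat \<Rightarrow> bool) \<Rightarrow> (nat \<Rightarrow> bool) \<Rightarrow> bool" where
  "flips_to M e fr T e' fr' \<longleftrightarrow> T \<subseteq> free_peaks e fr \<inter> {..<M} \<and>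
     (\<forall>t<M. e' t = flip e T t) \<and> (\<forall>t\<le>M. t \<notin> T \<longrightarrow> fr' t = fr t)"

lemma odd_east_run_cong:
  assumes "\<And>s. s < t \<Longrightarrow> e s = e' s" "\<And>s. s < t \<Longrightarrow> e s \<Longrightarrow> fr (Suc s) = fr' (Suc s)"
  shows "odd_east_run e fr t = odd_east_run e' fr' t"
  using assms by (induction t) auto

lemma odd_north_run_end [simp]: "\<not> odd_north_run M e fr M"
  by (simp add: odd_north_run_def)

lemma odd_north_run_step:
  assumes "t < M"
  shows "odd_north_run M e fr t \<longleftrightarrow> \<not> e t \<and> fr t \<and> \<not> odd_north_run M e fr (Suc t)"
proof -
  have "M - t = Suc (M - Suc t)" using assms by simp
  moreover have "M - Suc (M - Suc t) = t" using assms by simp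
  ultimately show ?thesis using assms by (simp add: odd_north_run_def)
qed

text \<open>Reversing the path and exchanging East with North sends vertex \<open>t\<close> to
  \<open>M - t\<close> and step \<open>t\<close> to \<open>M - Suc t\<close>. Applied twice this is
  the identity on the relevant range, so North runs of the reflected path are East runs of the
  original.\<close>

lemma odd_north_run_reflect:
  assumes "t \<le> M"
  shows "odd_north_run M (\<lambda>s. \<not> e (M - Suc s)) (\<lambda>s. fr (M - s)) (M - t) = odd_east_run e fr t"
  unfolding odd_north_run_def using assms by (auto intro!: odd_east_run_cong)

lemma odd_odd_peak_reflect:
  "odd_odd_peak M (\<lambda>s. \<not> e (M - Suc s)) (\<lambda>s. fr (M - s)) \<longleftrightarrow> odd_odd_peak M e fr"
proof -
  let ?e = "\<lambda>s. \<not> e (M - Suc s)" and ?fr = "\<lambda>s. fr (M - s)"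
  have *: "odd_east_run ?e ?fr (M - t) \<and> odd_north_run M ?e ?fr (M - t) \<longleftrightarrow>
      odd_north_run M e fr t \<and> odd_east_run e fr t" if "t \<le> M" for t
    using odd_north_run_reflect[OF that, of e fr] by (simp add: odd_north_run_def[of M e fr])
  show ?thesis
  proof
    assume "odd_odd_peak M ?e ?fr"
    then obtain t where "t \<le> M" "odd_east_run ?e ?fr t" "odd_north_run M ?e ?fr t"
      unfolding odd_odd_peak_def by blast
    then show "odd_odd_peak M e fr"
      using *[of "M - t"] unfolding odd_odd_peak_def by (intro exI[of _ "M - t"]) simp
  next
    assume "odd_odd_peak M e fr"
    then obtain t where "t \<le> M" "odd_east_run e fr t" "odd_north_run M e fr t"
      unfolding odd_odd_peak_def by blast
    then show "odd_odd_peak M ?e ?fr"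
      using *[of t] unfolding odd_odd_peak_def by (intro exI[of _ "M - t"]) simp
  qed
qed

lemma flips_to_reflect:
  assumes "flips_to M e fr T e' fr'"
  shows "flips_to M (\<lambda>s. \<not> e (M - Suc s)) (\<lambda>s. fr (M - s)) ((\<lambda>t. M - t) ` T)
           (\<lambda>s. \<not> e' (M - Suc s)) (\<lambda>s. fr' (M - s))"
proof -
  have T: "0 < t" "t < M" "e (t - 1)" "\<not> e t" "fr t" if "t \<in> T" for t
    using assms that by (auto simp: flips_to_def free_peaks_def)
  have mem: "s \<in> (\<lambda>t. M - t) ` T \<longleftrightarrow> M - s \<in> T" if "s \<le> M" for s
    using that T(2) by (force simp: image_iff)
  show ?thesis
    unfolding flips_to_def
  proof (intro conjI allI impI)
    show "(\<lambda>t. M - t) ` T \<subseteq> free_peaks (\<lambda>s. \<not> e (M - Suc s)) (\<lambda>s. fr (M - s)) \<inter> {..<M}"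
    proof
      fix s assume "s \<in> (\<lambda>t. M - t) ` T"
      then obtain t where t: "t \<in> T" "s = M - t" by blast
      have "M - Suc (M - t) = t - 1" "M - Suc (M - t - 1) = t" "M - (M - t) = t"
        using T[OF t(1)] by auto
      then show "s \<in> free_peaks (\<lambda>s. \<not> e (M - Suc s)) (\<lambda>s. fr (M - s)) \<inter> {..<M}"
        using T[OF t(1)] t(2) by (simp add: free_peaks_def)
    qed
    fix s
    show "(\<not> e' (M - Suc s)) = flip (\<lambda>s. \<not> e (M - Suc s)) ((\<lambda>t. M - t) ` T) s" if "s < M"
    proof -
      have "Suc (M - Suc s) = M - s" using that by simp
      \<comment> \<open>Adjacent vertices cannot both be peaks. Without this, the precedence that
        \<open>flip\<close> gives to \<open>Suc t\<close> over \<open>t\<close> would be reversed by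
        the reflection.\<close>
      moreover have "\<not> (M - s \<in> T \<and> M - Suc s \<in> T)"
        using T(3,4) calculation by (metis diff_Suc_1)
      moreover have "e' (M - Suc s) = flip e T (M - Suc s)"
        using assms that by (simp add: flips_to_def)
      ultimately show ?thesis
        using that by (auto simp: flip_def mem)
    qed
    show "fr' (M - s) = fr (M - s)" if "s \<le> M" "s \<notin> (\<lambda>t. M - t) ` T"
      using assms that by (simp add: flips_to_def mem)
  qed
qed

section \<open>From a path without odd pairs, every move creates one\<close>

text \<open>Walk back from \<open>s\<close> over East steps. The parity can change only if the North
  step in front of them is flipped to East. That step is free and is followed by an East step, so it
  is a North run of length 1.\<close>

lemma changed_east_run:
  assumes flips: "flips_to M e fr T e' fr'"
  shows "s < M \<Longrightarrow> e s \<Longrightarrow> odd_east_run e fr s \<noteq> odd_east_run e' fr' s \<Longrightarrow>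
    \<exists>k\<in>T. k < s \<and> odd_north_run M e fr k"
proof (induction s)
  case 0
  then show ?case by simp
next
  case (Suc k)
  have T: "0 < t" "t < M" "e (t - 1)" "\<not> e t" "fr t" if "t \<in> T" for t
    using flips that by (auto simp: flips_to_def free_peaks_def)
  have notin: "Suc k \<notin> T" using T Suc.prems by blast
  have e': "e' k \<longleftrightarrow> k \<in> T \<or> e k" and fr': "fr' (Suc k) = fr (Suc k)"
    using flips Suc.prems(1) notin by (auto simp: flips_to_def flip_def)
  show ?case
  proof (cases "e k")
    case True
    then have "odd_east_run e fr k \<noteq> odd_east_run e' fr' k"
      using Suc.prems(3) e' fr' by auto
    then show ?thesis using Suc.IH Suc.prems(1) True by (metis Suc_lessD less_SucI)
  next
    case False
    then have "k \<in> T" using Suc.prems(3) e' by auto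
    moreover have "odd_north_run M e fr k"
      using T[OF calculation] Suc.prems by (simp add: odd_north_run_step)
    ultimately show ?thesis by blast
  qed
qed

text \<open>The flip leaves a single North step at \<open>t - 1\<close>. If the odd East run before
  it survives, an odd pair results. Otherwise that run was changed by a flip at some
  \<open>k\<close> further left with an odd North run; as there was no odd pair, the East run at
  \<open>k\<close> is even, and the argument repeats at \<open>k\<close>.\<close>

lemma flip_even_east_run:
  assumes flips: "flips_to M e fr T e' fr'" and good: "\<not> odd_odd_peak M e fr"
  shows "t \<in> T \<Longrightarrow> odd_east_run e fr (t - 1) \<Longrightarrow> odd_odd_peak M e' fr'"
proof (induction t rule: less_induct)
  case (less t)
  have T: "0 < t" "t < M" "e (t - 1)" "\<not> e t" "fr t" if "t \<in> T" for t
    using flips that by (auto simp: flips_to_def free_peaks_def)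
  obtain s where s: "t = Suc s" using T[OF less.prems(1)] by (cases t) auto
  have es: "e s" "s < M" "\<not> e t" "t < M" using T[OF less.prems(1)] s by auto
  then have "s \<notin> T" "Suc t \<notin> T" using T(3,4) by force+
  then have "\<not> e' s" "e' t" "fr' s = fr s"
    using flips es less.prems(1) s by (auto simp: flips_to_def flip_def)
  \<comment> \<open>The last step of the odd East run is free and ends at \<open>s\<close>; this
    vertex is also the upper end of the new North step.\<close>
  moreover have "fr s" using less.prems(2) s by (cases s) auto
  ultimately have north: "odd_north_run M e' fr' s"
    using es s by (simp add: odd_north_run_step)
  show ?case
  proof (cases "odd_east_run e' fr' s")
    case True
    then show ?thesis using north es unfolding odd_odd_peak_def by (meson less_imp_le)
  next
    case False
    then obtain k where k: "k \<in> T" "k < s" "odd_north_run M e fr k"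
      using changed_east_run[OF flips es(2,1)] less.prems(2) s by auto
    then have "\<not> odd_east_run e fr k" using good es unfolding odd_odd_peak_def
      by (meson less_imp_le less_trans)
    then have "odd_east_run e fr (k - 1)" using T[OF k(1)] by (cases k) auto
    moreover have "k < t" using k(2) s by simp
    ultimately show ?thesis using less.IH k(1) by blast
  qed
qed

text \<open>A flipped peak is not an odd pair, so one of its two runs is even. An even East run is
  the previous lemma, an even North run its reflection.\<close>

lemma flip_creates_odd_odd_peak:
  assumes flips: "flips_to M e fr T e' fr'" and "T \<noteq> {}" and good: "\<not> odd_odd_peak M e fr"
  shows "odd_odd_peak M e' fr'"
proof -
  obtain t where t: "t \<in> T" using assms(2) by blast
  then have peak: "0 < t" "t < M" "e (t - 1)" "\<not> e t" "fr t"
    using flips by (auto simp: flips_to_def free_peaks_def)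
  have "\<not> odd_east_run e fr t \<or> \<not> odd_north_run M e fr t"
    using good peak unfolding odd_odd_peak_def by (meson less_imp_le)
  then show ?thesis
  proof
    assume "\<not> odd_east_run e fr t"
    then have "odd_east_run e fr (t - 1)" using peak by (cases t) auto
    then show ?thesis using flip_even_east_run[OF flips good t] by blast
  next
    let ?e = "\<lambda>s. \<not> e (M - Suc s)" and ?fr = "\<lambda>s. fr (M - s)"
    assume "\<not> odd_north_run M e fr t"
    then have "odd_north_run M e fr (Suc t)" using peak odd_north_run_step by blast
    then have "odd_east_run ?e ?fr (M - t - 1)" by (simp add: odd_north_run_def)
    moreover have "M - t \<in> (\<lambda>t. M - t) ` T" using t by blast
    ultimately have "odd_odd_peak M (\<lambda>s. \<not> e' (M - Suc s)) (\<lambda>s. fr' (M - s))"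
      using flip_even_east_run[OF flips_to_reflect[OF flips]] good
      by (simp add: odd_odd_peak_reflect)
    then show ?thesis by (simp add: odd_odd_peak_reflect)
  qed
qed

section \<open>From a path with an odd pair, some move removes them all\<close>

text \<open>There are flips before vertex \<open>m\<close> that leave no odd pair before \<open>m\<close>, provided that an odd North run
  starts at \<open>m\<close> iff \<open>r\<close>; after these flips an odd East run ends at \<open>m\<close> iff \<open>v\<close>.\<close>

definition prefix_solution :: "(nat \<Rightarrow> bool) \<Rightarrow> (nat \<Rightarrow> bool) \<Rightarrow> nat \<Rightarrow> bool \<Rightarrow> bool \<Rightarrow> bool" where
  "prefix_solution e fr m r v \<longleftrightarrow> (\<exists>T P Q. T \<subseteq> free_peaks e fr \<inter> {..<m} \<and>
     \<not> P 0 \<and> (\<forall>t<m. P (Suc t) = (flip e T t \<and> fr (Suc t) \<and> \<not> P t)) \<and>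
     (\<forall>t<m. Q t = (\<not> flip e T t \<and> fr t \<and> \<not> Q (Suc t))) \<and>
     (\<forall>t<m. \<not> (P t \<and> Q t)) \<and> P m = v \<and> Q m = r)"

lemma prefix_solutionI:
  assumes "T \<subseteq> free_peaks e fr \<inter> {..<m}" "\<not> P 0" "P m = v" "Q m = r"
    and "\<And>t. t < m \<Longrightarrow> P (Suc t) = (flip e T t \<and> fr (Suc t) \<and> \<not> P t) \<and>
      Q t = (\<not> flip e T t \<and> fr t \<and> \<not> Q (Suc t)) \<and> \<not> (P t \<and> Q t)"
  shows "prefix_solution e fr m r v"
  unfolding prefix_solution_def using assms by blast

lemma prefix_solution_0: "prefix_solution e fr 0 r False"
  by (rule prefix_solutionI[of "{}" _ _ _ "\<lambda>_. False" _ "\<lambda>_. r"]) auto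

text \<open>Appends step \<open>m\<close> unchanged. \<open>P\<close> and \<open>Q\<close> are the
  parities of the East and North runs of the flipped path; the guess \<open>r\<close> at
  \<open>Suc m\<close> forces the guess at \<open>m\<close>, and the second hypothesis keeps
  \<open>m\<close> from being an odd pair.\<close>

lemma prefix_solution_keep:
  assumes "prefix_solution e fr m (\<not> e m \<and> fr m \<and> \<not> r) v" "\<not> (v \<and> \<not> e m \<and> fr m \<and> \<not> r)"
  shows "prefix_solution e fr (Suc m) r (e m \<and> fr (Suc m) \<and> \<not> v)"
proof -
  obtain T P Q where *: "T \<subseteq> free_peaks e fr \<inter> {..<m}" "\<not> P 0"
    "P m = v" "Q m = (\<not> e m \<and> fr m \<and> \<not> r)"
    "\<forall>t<m. P (Suc t) = (flip e T t \<and> fr (Suc t) \<and> \<not> P t)"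
    "\<forall>t<m. Q t = (\<not> flip e T t \<and> fr t \<and> \<not> Q (Suc t))"
    "\<forall>t<m. \<not> (P t \<and> Q t)"
    using assms(1) unfolding prefix_solution_def by blast
  have "m \<notin> T" "Suc m \<notin> T" using *(1) by auto
  then have flip: "flip e T m = e m" by (simp add: flip_def)
  let ?P = "P(Suc m := e m \<and> fr (Suc m) \<and> \<not> v)" and ?Q = "Q(Suc m := r)"
  show ?thesis
  proof (rule prefix_solutionI[of T _ _ _ ?P _ ?Q])
    fix t assume "t < Suc m"
    then consider "t < m" | "t = m" by linarith
    then show "?P (Suc t) = (flip e T t \<and> fr (Suc t) \<and> \<not> ?P t) \<and>
        ?Q t = (\<not> flip e T t \<and> fr t \<and> \<not> ?Q (Suc t)) \<and> \<not> (?P t \<and> ?Q t)"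
    proof cases
      case 1
      then show ?thesis using *(5-7)[rule_format, OF 1] by simp
    next
      case 2
      then show ?thesis using *(3,4) assms(2) flip by simp
    qed
  qed (use *(1-4) in auto)
qed

text \<open>The flip at \<open>Suc m\<close> decouples the two sides. The part before
  \<open>m\<close> meets a single North step, which counts iff \<open>fr m\<close>, and the part
  after \<open>Suc (Suc m)\<close> is preceded by a single East step, whatever \<open>r\<close>
  is.\<close>

lemma prefix_solution_flip:
  assumes "prefix_solution e fr m (fr m) v" "\<not> (v \<and> fr m)"
    and "e m" "\<not> e (Suc m)" "fr (Suc m)"
  shows "prefix_solution e fr (Suc (Suc m)) r (fr (Suc (Suc m)))"
proof -
  obtain T P Q where *: "T \<subseteq> free_peaks e fr \<inter> {..<m}" "\<not> P 0" "P m = v" "Q m = fr m"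
    "\<forall>t<m. P (Suc t) = (flip e T t \<and> fr (Suc t) \<and> \<not> P t)"
    "\<forall>t<m. Q t = (\<not> flip e T t \<and> fr t \<and> \<not> Q (Suc t))"
    "\<forall>t<m. \<not> (P t \<and> Q t)"
    using assms(1) unfolding prefix_solution_def by blast
  let ?T = "insert (Suc m) T"
  \<comment> \<open>After the flip a North step enters \<open>Suc m\<close> and an East step leaves
    it, so no run of either kind is recorded there.\<close>
  let ?P = "P(Suc m := False, Suc (Suc m) := fr (Suc (Suc m)))"
    and ?Q = "Q(Suc m := False, Suc (Suc m) := r)"
  have "m \<notin> T" "Suc m \<notin> T" "Suc (Suc m) \<notin> T" using *(1) by auto
  then have flip: "\<not> flip e ?T m" "flip e ?T (Suc m)" "\<And>t. t < m \<Longrightarrow> flip e ?T t = flip e T t"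
    by (auto simp: flip_def)
  show ?thesis
  proof (rule prefix_solutionI[of ?T _ _ _ ?P _ ?Q])
    show "?T \<subseteq> free_peaks e fr \<inter> {..<Suc (Suc m)}"
      using *(1) assms(3-5) by (auto simp: free_peaks_def)
    fix t assume "t < Suc (Suc m)"
    then consider "t < m" | "t = m" | "t = Suc m" by linarith
    then show "?P (Suc t) = (flip e ?T t \<and> fr (Suc t) \<and> \<not> ?P t) \<and>
        ?Q t = (\<not> flip e ?T t \<and> fr t \<and> \<not> ?Q (Suc t)) \<and> \<not> (?P t \<and> ?Q t)"
    proof cases
      case 1
      then show ?thesis using *(5-7)[rule_format, OF 1] flip(3)[OF 1] by simp
    next
      case 2
      then show ?thesis using *(3,4) assms(2) flip by simp
    next
      case 3
      then show ?thesis using flip by simp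
    qed
  qed (use *(1-4) in auto)
qed

text \<open>The first clause is the goal; the others strengthen the induction. A free North step
  followed by an even North run needs guess \<open>True\<close> with no odd East run before it. The
  third clause provides this unless an East step precedes; in that case the second clause, taken
  before the East step, decides between keeping and flipping the peak.\<close>

lemma prefix_solution_exists:
  "(\<exists>v. prefix_solution e fr m False v) \<and>
   (prefix_solution e fr m False True \<or> prefix_solution e fr m True False) \<and>
   (m = 0 \<or> \<not> e (m - 1) \<longrightarrow> prefix_solution e fr m True False)"
proof (induction m rule: less_induct)
  case (less n)
  show ?case
  proof (cases n)
    case 0
    then show ?thesis using prefix_solution_0 by auto
  next
    case (Suc m)
    have IH: "\<exists>v. prefix_solution e fr m False v"
      "m = 0 \<or> \<not> e (m - 1) \<Longrightarrow> prefix_solution e fr m True False"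
      using less.IH[of m] Suc by auto
    obtain v where v: "prefix_solution e fr m False v" using IH(1) by blast
    show ?thesis
    proof (cases "e m")
      case True
      \<comment> \<open>An East step makes the guess at \<open>m\<close> equal to
        \<open>False\<close> for both values of \<open>r\<close>, so the same final parity is
        available with either guess. Whichever parity it is, one alternative of the second clause
        holds.\<close>
      then have "prefix_solution e fr n r (fr n \<and> \<not> v)" for r
        using prefix_solution_keep[of e fr m r v] v Suc by simp
      then show ?thesis using True Suc by (metis (full_types) diff_Suc_1 nat.simps(3))
    next
      case False
      have "prefix_solution e fr n True False"
        using prefix_solution_keep[of e fr m True v] v Suc False by simp
      moreover have "\<exists>v. prefix_solution e fr n False v"
      proof (cases "fr m")
        case False
        then show ?thesis using prefix_solution_keep[of e fr m False v] v Suc by auto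
      next
        case True
        have keep: ?thesis if "prefix_solution e fr m True False"
          using prefix_solution_keep[of e fr m False False] that \<open>\<not> e m\<close> True Suc by auto
        show ?thesis
        proof (cases "m = 0 \<or> \<not> e (m - 1)")
          case True
          then show ?thesis using keep IH(2) by blast
        next
          case prev: False
          then obtain k where k: "m = Suc k" "e k" by (cases m) auto
          have IHk: "\<exists>v. prefix_solution e fr k False v"
            "prefix_solution e fr k False True \<or> prefix_solution e fr k True False"
            using less.IH[of k] k Suc by auto
          from IHk(2) show ?thesis
          proof
            \<comment> \<open>The East run becomes even when step \<open>k\<close> is appended, so
              the peak at \<open>m\<close> may stay.\<close>
            assume "prefix_solution e fr k False True"
            then have "prefix_solution e fr m True False"
              using prefix_solution_keep[of e fr k True True] k by simp
            then show ?thesis by (rule keep)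
          next
            assume "prefix_solution e fr k True False"
            \<comment> \<open>Flipping the peak requires the guess \<open>fr k\<close> at
              \<open>k\<close>: if \<open>k\<close> is free this is the present case, otherwise the
              first clause supplies it.\<close>
            then obtain u where "prefix_solution e fr k (fr k) u" "\<not> (u \<and> fr k)"
              using IHk(1) by (cases "fr k") auto
            then show ?thesis
              using prefix_solution_flip[of e fr k u False] k \<open>\<not> e m\<close> True Suc by auto
          qed
        qed
      qed
      ultimately show ?thesis by blast
    qed
  qed
qed

lemma exists_flip_removing_odd_odd_peaks:
  assumes "odd_odd_peak M e fr"
  obtains T where "T \<noteq> {}" "T \<subseteq> free_peaks e fr \<inter> {..<M}"
    "\<And>e' fr'. flips_to M e fr T e' fr' \<Longrightarrow> \<not> odd_odd_peak M e' fr'"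
proof -
  \<comment> \<open>No North run starts at the final vertex, so the guess there is
    \<open>False\<close>.\<close>
  obtain v where "prefix_solution e fr M False v" using prefix_solution_exists by blast
  then obtain T P Q where *: "T \<subseteq> free_peaks e fr \<inter> {..<M}" "\<not> P 0" "\<not> Q M"
    "\<forall>t<M. P (Suc t) = (flip e T t \<and> fr (Suc t) \<and> \<not> P t)"
    "\<forall>t<M. Q t = (\<not> flip e T t \<and> fr t \<and> \<not> Q (Suc t))"
    "\<forall>t<M. \<not> (P t \<and> Q t)"
    unfolding prefix_solution_def by blast
  have good: "\<not> odd_odd_peak M e' fr'" if flips: "flips_to M e fr T e' fr'" for e' fr'
  proof -
    have e': "e' t = flip e T t" if "t < M" for t
      using flips that by (simp add: flips_to_def)
    have fr': "fr' t = fr t" if "t \<le> M" "t \<notin> T" for t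
      using flips that by (simp add: flips_to_def)
    have P: "odd_east_run e' fr' t = P t" if "t \<le> M" for t
      using that
    proof (induction t)
      case (Suc t)
      then show ?case using *(4)[rule_format, of t] e'[of t] fr'[of "Suc t"] by (auto simp: flip_def)
    qed (use *(2) in simp)
    have Q: "odd_north_run M e' fr' t = Q t" if "t \<le> M" for t
      using that
    proof (induction rule: inc_induct)
      case (step t)
      \<comment> \<open>If step \<open>t\<close> became North because \<open>Suc t\<close> was
        flipped, then \<open>t\<close> was not flipped, so \<open>fr'\<close> agrees with
        \<open>fr\<close> at the upper end of that step.\<close>
      have "t \<notin> T" if "Suc t \<in> T"
        using subsetD[OF *(1), of t] subsetD[OF *(1) that] by (auto simp: free_peaks_def)
      then show ?case
        using step *(5)[rule_format, of t] e'[of t] fr'[of t] by (auto simp: odd_north_run_step flip_def)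
    qed (use *(3) in simp)
    show ?thesis
      using P Q *(3,6) unfolding odd_odd_peak_def by (metis le_neq_implies_less)
  qed
  moreover have "T \<noteq> {}"
  proof
    assume "T = {}"
    then have "flips_to M e fr T e fr" by (simp add: flips_to_def flip_def)
    then show False using good assms by blast
  qed
  ultimately show ?thesis using that *(1) by blast
qed

section \<open>Kernels and winning strategies\<close>

text \<open>\<open>G\<close> is a kernel of the move graph on \<open>C\<close>: no move stays inside
  it, and every position outside has a move into it. The player facing \<open>G\<close> loses,
  because the opponent can always return there and the measure \<open>m\<close> ends the
  play.\<close>

lemma atniss_win_iff_not_kernel:
  fixes m :: "'a \<Rightarrow> nat"
  assumes desc: "\<And>x y. x \<in> C \<Longrightarrow> nontrivial_ungar_move L x y \<Longrightarrow> y \<in> C \<and> m y < m x"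
    and top: "\<top>\<^bsub>L\<^esub> \<in> C"
    and indep: "\<And>x y. x \<in> C \<Longrightarrow> x \<in> G \<Longrightarrow> nontrivial_ungar_move L x y \<Longrightarrow> y \<notin> G"
    and absorb: "\<And>x. x \<in> C \<Longrightarrow> x \<notin> G \<Longrightarrow> \<exists>y. nontrivial_ungar_move L x y \<and> y \<in> G"
  shows "atniss_win L \<longleftrightarrow> \<top>\<^bsub>L\<^esub> \<notin> G"
proof
  assume "atniss_win L"
  then obtain \<sigma> where strat: "atniss_strategy L \<sigma>"
    and win: "\<And>xs. ungar_play L xs \<Longrightarrow> atniss_follows \<sigma> xs \<Longrightarrow> ungar_stuck L (last xs) \<Longrightarrow>
      even (length xs)"
    unfolding atniss_win_def by blast
  have no_play: False
    if "ungar_play L xs" "atniss_follows \<sigma> xs" "odd (length xs)" "last xs \<in> C" "last xs \<in> G" for xs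
    using that
  proof (induction "m (last xs)" arbitrary: xs rule: less_induct)
    case less
    have "\<not> ungar_stuck L (last xs)" using win less.prems by blast
    then have y: "nontrivial_ungar_move L (last xs) (\<sigma> xs)"
      using strat less.prems unfolding atniss_strategy_def by blast
    then have yC: "\<sigma> xs \<in> C" "\<sigma> xs \<notin> G" "m (\<sigma> xs) < m (last xs)"
      using desc indep less.prems by blast+
    then obtain z where z: "nontrivial_ungar_move L (\<sigma> xs) z" "z \<in> G" using absorb by blast
    have zC: "z \<in> C" "m z < m (\<sigma> xs)" using desc z yC by blast+
    \<comment> \<open>Atniss leaves \<open>G\<close> by the prescribed move and Eeta returns to it,
      which gives a play of the same kind with smaller measure.\<close>
    let ?ys = "xs @ [\<sigma> xs, z]"
    have "ungar_play L ?ys"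
      using less.prems(1) y z by (auto simp: ungar_play_def successively_append_iff)
    moreover have "atniss_follows \<sigma> ?ys"
      unfolding atniss_follows_def
    proof (intro allI impI)
      fix i assume i: "Suc i < length ?ys \<and> odd (Suc i)"
      \<comment> \<open>Since \<open>length xs\<close> is odd, the only new position that binds
        Atniss is that of \<open>\<sigma> xs\<close>; the reply \<open>z\<close> stands at an even
        index.\<close>
      then have "Suc i < length xs \<or> Suc i = length xs"
        using less.prems(3) by (auto simp: less_Suc_eq)
      then show "?ys ! Suc i = \<sigma> (take (Suc i) ?ys)"
        using less.prems(2) i by (auto simp: atniss_follows_def nth_append)
    qed
    ultimately show False
      using less.hyps[of ?ys] less.prems(3) z zC yC by simp
  qed
  show "\<top>\<^bsub>L\<^esub> \<notin> G"
  proof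
    assume "\<top>\<^bsub>L\<^esub> \<in> G"
    then show False
      using no_play[of "[\<top>\<^bsub>L\<^esub>]"] top by (simp add: ungar_play_def atniss_follows_def)
  qed
next
  assume ntop: "\<top>\<^bsub>L\<^esub> \<notin> G"
  \<comment> \<open>The choice is arbitrary where no move into \<open>G\<close> exists; by the
    invariant \<open>inv\<close>, Atniss only ever moves from outside \<open>G\<close>, where one
    does.\<close>
  define \<sigma> where "\<sigma> xs = (SOME y. nontrivial_ungar_move L (last xs) y \<and> y \<in> G)" for xs
  have \<sigma>: "nontrivial_ungar_move L (last xs) (\<sigma> xs) \<and> \<sigma> xs \<in> G"
    if "last xs \<in> C" "last xs \<notin> G" for xs
    unfolding \<sigma>_def using someI_ex[OF absorb[OF that]] .
  have inv: "last xs \<in> C \<and> (odd (length xs) \<longleftrightarrow> last xs \<notin> G)"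
    if "ungar_play L xs" "atniss_follows \<sigma> xs" for xs
    using that
  proof (induction xs rule: rev_induct)
    case Nil
    then show ?case by (simp add: ungar_play_def)
  next
    case (snoc x xs)
    show ?case
    proof (cases "xs = []")
      case True
      then show ?thesis using snoc.prems top ntop by (simp add: ungar_play_def)
    next
      case False
      then have play: "ungar_play L xs" and move: "nontrivial_ungar_move L (last xs) x"
        using snoc.prems(1) by (auto simp: ungar_play_def successively_append_iff)
      have follows: "\<forall>i. Suc i < Suc (length xs) \<and> odd (Suc i) \<longrightarrow>
          (xs @ [x]) ! Suc i = \<sigma> (take (Suc i) (xs @ [x]))"
        using snoc.prems(2) by (simp add: atniss_follows_def)
      have "atniss_follows \<sigma> xs"
        unfolding atniss_follows_def
      proof (intro allI impI)
        fix i assume "Suc i < length xs \<and> odd (Suc i)"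
        then show "xs ! Suc i = \<sigma> (take (Suc i) xs)"
          using follows[rule_format, of i] by (simp add: nth_append)
      qed
      then have IH: "last xs \<in> C" "odd (length xs) \<longleftrightarrow> last xs \<notin> G"
        using snoc.IH play by auto
      have "x = \<sigma> xs" if "odd (length xs)"
        using follows[rule_format, of "length xs - 1"] that False by (simp add: nth_append)
      then show ?thesis using IH \<sigma>[of xs] indep[of "last xs" x] desc[of "last xs" x] move by auto
    qed
  qed
  show "atniss_win L"
    unfolding atniss_win_def atniss_strategy_def
  proof (intro exI[of _ \<sigma>] conjI allI impI)
    fix xs
    show "nontrivial_ungar_move L (last xs) (\<sigma> xs)"
      if "ungar_play L xs \<and> atniss_follows \<sigma> xs \<and> odd (length xs) \<and> \<not> ungar_stuck L (last xs)"
      using inv[of xs] \<sigma>[of xs] that by blast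
    show "even (length xs)"
      if "ungar_play L xs \<and> atniss_follows \<sigma> xs \<and> ungar_stuck L (last xs)"
      using inv[of xs] \<sigma>[of xs] that unfolding ungar_stuck_def by blast
  qed
qed

section \<open>Moves in an interval of Young's lattice\<close>

text \<open>The rows whose last cell is a removable corner of \<open>\<nu>\<close> lying outside
  \<open>\<mu>\<close>.\<close>

definition removable_rows :: "nat list \<Rightarrow> nat list \<Rightarrow> nat set" where
  "removable_rows \<mu> \<nu> = {i. row \<nu> (Suc i) < row \<nu> i \<and> row \<mu> i < row \<nu> i}"

definition shrinks_to :: "nat list \<Rightarrow> nat set \<Rightarrow> nat list \<Rightarrow> bool" where
  "shrinks_to \<nu> R \<nu>' \<longleftrightarrow> is_partition \<nu>' \<and> (\<forall>i. row \<nu>' i = row \<nu> i - (if i \<in> R then 1 else 0))"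

lemma carrier_young_interval:
  "\<nu> \<in> carrier (young_interval \<mu> lam) \<longleftrightarrow>
     is_partition \<nu> \<and> (\<forall>i. row \<mu> i \<le> row \<nu> i) \<and> (\<forall>i. row \<nu> i \<le> row lam i)"
  by (simp add: young_interval_def young_le_row)

lemma lless_young_interval:
  "x \<sqsubset>\<^bsub>young_interval \<mu> lam\<^esub> y \<longleftrightarrow> (\<forall>i. row x i \<le> row y i) \<and> x \<noteq> y"
  by (simp add: lless_def young_interval_def young_le_row)

lemma shrinks_to_carrier:
  assumes "\<nu> \<in> carrier (young_interval \<mu> lam)" "R \<subseteq> removable_rows \<mu> \<nu>" "shrinks_to \<nu> R \<nu>'"
  shows "\<nu>' \<in> carrier (young_interval \<mu> lam)"
proof -
  have "row \<mu> i \<le> row \<nu>' i \<and> row \<nu>' i \<le> row lam i" for i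
  proof -
    have "row \<mu> i \<le> row \<nu> i" "row \<nu> i \<le> row lam i" "i \<in> R \<Longrightarrow> row \<mu> i < row \<nu> i"
      using assms(1,2) by (auto simp: carrier_young_interval removable_rows_def)
    then show ?thesis using assms(3) by (auto simp: shrinks_to_def)
  qed
  then show ?thesis using assms(3) by (auto simp: carrier_young_interval shrinks_to_def)
qed

lemma shrinks_to_exists:
  assumes "is_partition \<nu>" "R \<subseteq> removable_rows \<mu> \<nu>"
  obtains \<nu>' where "shrinks_to \<nu> R \<nu>'"
proof -
  let ?f = "\<lambda>i. row \<nu> i - (if i \<in> R then 1 else 0)"
  have anti: "?f j \<le> ?f i" if "i \<le> j" for i j
  proof (cases "i = j")
    case False
    then have "row \<nu> j \<le> row \<nu> (Suc i)" "row \<nu> j \<le> row \<nu> i"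
      using row_antimono[OF assms(1)] that by auto
    moreover have "row \<nu> (Suc i) < row \<nu> i" if "i \<in> R"
      using assms(2) that by (auto simp: removable_rows_def)
    ultimately show ?thesis by auto
  qed simp
  have zero: "?f (length \<nu>) = 0" by (simp add: row_def)
  obtain \<nu>' where "is_partition \<nu>'" "\<And>i. row \<nu>' i = ?f i"
    using partition_of_rows[of ?f, OF anti zero] by blast
  then have "shrinks_to \<nu> R \<nu>'" by (simp add: shrinks_to_def)
  then show ?thesis by (rule that)
qed

text \<open>Below \<open>\<nu>\<close>, the last row where \<open>y\<close> is shorter ends in a
  removable corner. Removing this corner alone gives an element between \<open>y\<close> and
  \<open>\<nu>\<close>, so a cover must equal it.\<close>

lemma covered_by_young_interval:
  assumes \<nu>: "\<nu> \<in> carrier (young_interval \<mu> lam)"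
  shows "y \<in> covered_by (young_interval \<mu> lam) \<nu> \<longleftrightarrow> (\<exists>i\<in>removable_rows \<mu> \<nu>. shrinks_to \<nu> {i} y)"
proof
  let ?L = "young_interval \<mu> lam"
  assume "y \<in> covered_by ?L \<nu>"
  then have y: "y \<in> carrier ?L" "\<And>i. row y i \<le> row \<nu> i" "y \<noteq> \<nu>"
    and cover: "\<And>z. z \<in> carrier ?L \<Longrightarrow> y \<sqsubset>\<^bsub>?L\<^esub> z \<Longrightarrow> z \<sqsubset>\<^bsub>?L\<^esub> \<nu> \<Longrightarrow> False"
    unfolding covered_by_def lless_young_interval by auto
  let ?D = "{i. row y i < row \<nu> i}"
  have "?D \<subseteq> {..<length \<nu>}" by (auto simp: row_def split: if_splits)
  then have fin: "finite ?D" by (rule finite_subset) simp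
  have "?D \<noteq> {}"
  proof
    assume "?D = {}"
    then have "row y i = row \<nu> i" for i using y(2)[of i] by (simp add: order.order_iff_strict)
    then show False using partition_eqI y(1,3) \<nu> by (auto simp: carrier_young_interval)
  qed
  \<comment> \<open>With the largest index, the next row of \<open>y\<close> is as long as that of
    \<open>\<nu>\<close>; hence row \<open>i\<close> of \<open>\<nu>\<close> is strictly longer than
    its next row.\<close>
  define i where "i = Max ?D"
  have i: "row y i < row \<nu> i" using Max_in[OF fin \<open>?D \<noteq> {}\<close>] by (simp add: i_def)
  have "Suc i \<notin> ?D" using Max_ge[OF fin, of "Suc i"] by (auto simp: i_def)
  then have "row \<nu> (Suc i) \<le> row y (Suc i)" by simp
  also have "\<dots> \<le> row y i" using y(1) row_antimono by (simp add: carrier_young_interval)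
  finally have rem: "i \<in> removable_rows \<mu> \<nu>"
    using i y(1) le_less_trans[of "row \<mu> i" "row y i" "row \<nu> i"]
    by (simp add: removable_rows_def carrier_young_interval)
  obtain z where z: "shrinks_to \<nu> {i} z"
    using shrinks_to_exists[of \<nu> "{i}" \<mu>] \<nu> rem by (auto simp: carrier_young_interval)
  have zC: "z \<in> carrier ?L" using shrinks_to_carrier[OF \<nu> _ z] rem by simp
  have "row y k \<le> row z k" for k
    using z y(2)[of k] i by (auto simp: shrinks_to_def)
  moreover have "row z i < row \<nu> i" "\<And>k. row z k \<le> row \<nu> k"
    using z i by (auto simp: shrinks_to_def)
  then have "z \<sqsubset>\<^bsub>?L\<^esub> \<nu>" by (auto simp: lless_young_interval)
  ultimately have "y = z" using cover[OF zC] by (auto simp: lless_young_interval)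
  then show "\<exists>i\<in>removable_rows \<mu> \<nu>. shrinks_to \<nu> {i} y" using z rem by blast
next
  let ?L = "young_interval \<mu> lam"
  assume "\<exists>i\<in>removable_rows \<mu> \<nu>. shrinks_to \<nu> {i} y"
  then obtain i where i: "i \<in> removable_rows \<mu> \<nu>" and y: "shrinks_to \<nu> {i} y" by blast
  have yC: "y \<in> carrier ?L" using shrinks_to_carrier[OF \<nu> _ y] i by simp
  have yi: "row y i = row \<nu> i - 1" "row \<nu> i > 0" "\<And>k. k \<noteq> i \<Longrightarrow> row y k = row \<nu> k"
    using y i by (auto simp: shrinks_to_def removable_rows_def)
  have "row y i < row \<nu> i" "\<And>k. row y k \<le> row \<nu> k"
    using y yi by (auto simp: shrinks_to_def)
  then have "y \<sqsubset>\<^bsub>?L\<^esub> \<nu>" by (auto simp: lless_young_interval)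
  moreover have False if z: "z \<in> carrier ?L" "y \<sqsubset>\<^bsub>?L\<^esub> z" "z \<sqsubset>\<^bsub>?L\<^esub> \<nu>" for z
  proof -
    have le: "row y k \<le> row z k" "row z k \<le> row \<nu> k" for k
      using z by (auto simp: lless_young_interval)
    have other: "row z k = row \<nu> k" if "k \<noteq> i" for k using le[of k] yi(3)[OF that] by simp
    have "row z i = row y i \<or> row z i = row \<nu> i" using le[of i] yi by linarith
    then have "(\<forall>k. row z k = row y k) \<or> (\<forall>k. row z k = row \<nu> k)" using other yi(3) by metis
    then show False
      using partition_eqI[of z y] partition_eqI[of z \<nu>] z yC \<nu>
      by (auto simp: lless_young_interval carrier_young_interval)
  qed
  ultimately show "y \<in> covered_by ?L \<nu>" using yC unfolding covered_by_def by blast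
qed

text \<open>The meet is a choice term; antisymmetry of the interval identifies it with any greatest
  lower bound.\<close>

lemma inf_young_interval:
  assumes "greatest (young_interval \<mu> lam) x (Lower (young_interval \<mu> lam) A)"
  shows "\<Sqinter>\<^bsub>young_interval \<mu> lam\<^esub> A = x"
proof -
  interpret lattice "young_interval \<mu> lam" by (rule young_interval_lattice)
  show ?thesis
    unfolding inf_def using assms by (blast intro: some_equality greatest_unique)
qed

lemma top_young_interval:
  assumes "is_partition lam" "\<mu> \<le>\<^sub>Y lam"
  shows "\<top>\<^bsub>young_interval \<mu> lam\<^esub> = lam"
proof -
  interpret lattice "young_interval \<mu> lam" by (rule young_interval_lattice)
  have "greatest (young_interval \<mu> lam) lam (carrier (young_interval \<mu> lam))"
    using assms by (auto simp: greatest_def young_interval_def young_le_def)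
  then show ?thesis
    unfolding top_def by (blast intro: some_equality greatest_unique)
qed

text \<open>Meets are row-wise minima, and each member of \<open>T\<close> shortens one row by one
  cell, so the meet shortens exactly the rows involved.\<close>

lemma inf_covered_young_interval:
  assumes \<nu>: "\<nu> \<in> carrier (young_interval \<mu> lam)"
    and T: "T \<subseteq> covered_by (young_interval \<mu> lam) \<nu>"
    and \<nu>': "shrinks_to \<nu> {i. \<exists>y\<in>T. shrinks_to \<nu> {i} y} \<nu>'" "\<nu>' \<in> carrier (young_interval \<mu> lam)"
  shows "\<Sqinter>\<^bsub>young_interval \<mu> lam\<^esub> ({\<nu>} \<union> T) = \<nu>'"
proof (rule inf_young_interval)
  let ?L = "young_interval \<mu> lam" and ?R = "{i. \<exists>y\<in>T. shrinks_to \<nu> {i} y}"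
  have row': "row \<nu>' k = row \<nu> k - (if k \<in> ?R then 1 else 0)" for k
    using \<nu>'(1) by (simp add: shrinks_to_def)
  have sub: "{\<nu>} \<union> T \<subseteq> carrier ?L" using \<nu> T by (auto simp: covered_by_def)
  have Lower: "z \<in> Lower ?L ({\<nu>} \<union> T) \<longleftrightarrow>
      z \<in> carrier ?L \<and> (\<forall>k. row z k \<le> row \<nu> k) \<and> (\<forall>y\<in>T. \<forall>k. row z k \<le> row y k)" for z
    using sub by (auto simp: Lower_def young_interval_def young_le_row)
  have below: "row \<nu>' k \<le> row y k" if y: "y \<in> T" for y k
  proof -
    obtain i where i: "shrinks_to \<nu> {i} y"
      using y T covered_by_young_interval[OF \<nu>] by blast
    then have "i \<in> ?R" using y by blast
    then show ?thesis using i row'[of k] by (auto simp: shrinks_to_def)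
  qed
  have above: "row z k \<le> row \<nu>' k" if "z \<in> Lower ?L ({\<nu>} \<union> T)" for z k
  proof -
    have z: "row z k \<le> row \<nu> k" "\<And>y. y \<in> T \<Longrightarrow> row z k \<le> row y k"
      using that unfolding Lower by blast+
    show ?thesis
    proof (cases "k \<in> ?R")
      case True
      then obtain y where "y \<in> T" "shrinks_to \<nu> {k} y" by blast
      then have "row z k \<le> row \<nu> k - 1" using z(2)[of y] by (simp add: shrinks_to_def)
      then show ?thesis using row'[of k] True by simp
    next
      case False
      then show ?thesis using z(1) row'[of k] by simp
    qed
  qed
  have "\<nu>' \<in> Lower ?L ({\<nu>} \<union> T)"
    unfolding Lower using \<nu>'(2) below row' by simp
  moreover have "Lower ?L ({\<nu>} \<union> T) \<subseteq> carrier ?L" by (rule Lower_closed)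
  moreover have "z \<sqsubseteq>\<^bsub>?L\<^esub> \<nu>'" if "z \<in> Lower ?L ({\<nu>} \<union> T)" for z
    using above[OF that] by (simp add: young_interval_def young_le_row)
  ultimately show "greatest ?L \<nu>' (Lower ?L ({\<nu>} \<union> T))"
    unfolding greatest_def by blast
qed

lemma nontrivial_ungar_move_young_interval:
  assumes \<nu>: "\<nu> \<in> carrier (young_interval \<mu> lam)"
  shows "nontrivial_ungar_move (young_interval \<mu> lam) \<nu> \<nu>' \<longleftrightarrow>
     (\<exists>R. R \<noteq> {} \<and> R \<subseteq> removable_rows \<mu> \<nu> \<and> shrinks_to \<nu> R \<nu>')"
proof
  let ?L = "young_interval \<mu> lam"
  have part: "is_partition \<nu>" using \<nu> by (simp add: carrier_young_interval)
  \<comment> \<open>A removable row is nonempty, so shortening it is visible and \<open>y\<close>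
    determines the row. This makes sets of covers correspond to sets of rows.\<close>
  have inj: "i = j" if "shrinks_to \<nu> {i} y" "shrinks_to \<nu> {j} y" "i \<in> removable_rows \<mu> \<nu>" for i j y
  proof (rule ccontr)
    assume "i \<noteq> j"
    have "row \<nu> i - 1 = row \<nu> i" using that(1,2) \<open>i \<noteq> j\<close> unfolding shrinks_to_def
      by (metis (mono_tags) diff_zero singletonD singletonI)
    then show False using that(3) by (auto simp: removable_rows_def)
  qed
  {
    assume "nontrivial_ungar_move ?L \<nu> \<nu>'"
    then obtain T where T: "T \<subseteq> covered_by ?L \<nu>" "T \<noteq> {}" "\<nu>' = \<Sqinter>\<^bsub>?L\<^esub> ({\<nu>} \<union> T)"
      unfolding nontrivial_ungar_move_def by blast
    let ?R = "{i. \<exists>y\<in>T. shrinks_to \<nu> {i} y}"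
    have "?R \<noteq> {}" "?R \<subseteq> removable_rows \<mu> \<nu>"
      using T(1,2) covered_by_young_interval[OF \<nu>] inj by blast+
    moreover from this obtain x where x: "shrinks_to \<nu> ?R x"
      using shrinks_to_exists[OF part] by blast
    moreover have "\<nu>' = x"
      using inf_covered_young_interval[OF \<nu> T(1) x] shrinks_to_carrier[OF \<nu> _ x] T(3) calculation(2)
      by simp
    ultimately show "\<exists>R. R \<noteq> {} \<and> R \<subseteq> removable_rows \<mu> \<nu> \<and> shrinks_to \<nu> R \<nu>'"
      by (intro exI[of _ ?R]) simp
  next
    assume "\<exists>R. R \<noteq> {} \<and> R \<subseteq> removable_rows \<mu> \<nu> \<and> shrinks_to \<nu> R \<nu>'"
    then obtain R where R: "R \<noteq> {}" "R \<subseteq> removable_rows \<mu> \<nu>" "shrinks_to \<nu> R \<nu>'" by blast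
    let ?T = "{y. \<exists>i\<in>R. shrinks_to \<nu> {i} y}"
    have ex: "\<exists>y. shrinks_to \<nu> {i} y" if "i \<in> R" for i
      using shrinks_to_exists[OF part, of "{i}" \<mu>] R(2) that by blast
    then have "?T \<noteq> {}" using R(1) by blast
    moreover have T: "?T \<subseteq> covered_by ?L \<nu>"
      using R(2) covered_by_young_interval[OF \<nu>] by blast
    moreover have "{i. \<exists>y\<in>?T. shrinks_to \<nu> {i} y} = R"
      using ex inj R(2) by blast
    then have "\<Sqinter>\<^bsub>?L\<^esub> ({\<nu>} \<union> ?T) = \<nu>'"
      using inf_covered_young_interval[OF \<nu> T, of \<nu>'] R(3) shrinks_to_carrier[OF \<nu> R(2,3)] by simp
    ultimately show "nontrivial_ungar_move ?L \<nu> \<nu>'"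
      unfolding nontrivial_ungar_move_def by blast
  }
qed

section \<open>Translation from partitions to paths in a box\<close>

text \<open>In the box with \<open>K\<close> rows, the North step of row \<open>i\<close> is step \<open>row \<nu> i + K - 1 - i\<close>, and vertex
  \<open>t\<close> lies on the diagonal \<open>j - i = t - K\<close>; it is free iff that diagonal has a cell in \<open>\<nu>\<close> but not in
  \<open>\<mu>\<close>. The formulas avoid truncated subtraction.\<close>

definition east_step :: "nat \<Rightarrow> nat list \<Rightarrow> nat \<Rightarrow> bool" where
  "east_step K \<nu> t \<longleftrightarrow> \<not> (\<exists>i<K. t + i + 1 = row \<nu> i + K)"

definition free_vertex :: "nat \<Rightarrow> nat list \<Rightarrow> nat list \<Rightarrow> nat \<Rightarrow> bool" where
  "free_vertex K \<mu> \<nu> t \<longleftrightarrow> (\<exists>i. row \<mu> i + K \<le> i + t \<and> i + t < row \<nu> i + K)"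

lemma removable_less_length: "i \<in> removable_rows \<mu> \<nu> \<Longrightarrow> i < length \<nu>"
  by (auto simp: removable_rows_def row_def split: if_splits)

lemma length_young_interval:
  assumes "\<nu> \<in> carrier (young_interval \<mu> lam)"
  shows "length \<nu> \<le> length lam"
  using assms row_pos_iff[of \<nu> "length lam"]
  by (metis carrier_young_interval le_zero_eq linorder_not_le order_refl row_def neq0_conv)

text \<open>The corner of row \<open>i\<close> is the peak at the vertex where the North step of
  that row starts. \<open>K\<close> is fixed by \<open>lam\<close>, so all \<open>\<nu>\<close> in
  the interval give paths in one box; empty rows of \<open>\<nu>\<close> are initial North
  steps.\<close>

lemma shrinks_to_flips_to:
  assumes \<nu>: "\<nu> \<in> carrier (young_interval \<mu> lam)" and lam: "is_partition lam"
    and R: "R \<subseteq> removable_rows \<mu> \<nu>" and \<nu>': "shrinks_to \<nu> R \<nu>'"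
  defines "K \<equiv> length lam"
  shows "flips_to (K + row lam 0) (east_step K \<nu>) (free_vertex K \<mu> \<nu>)
     ((\<lambda>i. row \<nu> i + K - Suc i) ` R) (east_step K \<nu>') (free_vertex K \<mu> \<nu>')"
proof -
  let ?T = "(\<lambda>i. row \<nu> i + K - Suc i) ` R"
  have part: "is_partition \<nu>" using \<nu> by (simp add: carrier_young_interval)
  have row': "row \<nu>' k = row \<nu> k - (if k \<in> R then 1 else 0)" for k
    using \<nu>' by (simp add: shrinks_to_def)
  have RD: "i < K" "row \<nu> (Suc i) < row \<nu> i" "row \<mu> i < row \<nu> i" if "i \<in> R" for i
    using R that removable_less_length[of i \<mu> \<nu>] length_young_interval[OF \<nu>]
    by (auto simp: removable_rows_def K_def)
  \<comment> \<open>Since \<open>row \<nu> i - i\<close> strictly decreases in \<open>i\<close> over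
    the integers, each step index belongs to at most one row.\<close>
  have inj: "i = j" if "t + i + 1 = row \<nu> i + K" "t + j + 1 = row \<nu> j + K" for i j t
    using that row_antimono[OF part, of i j] row_antimono[OF part, of j i] by linarith
  have T: "t \<in> ?T \<longleftrightarrow> (\<exists>i\<in>R. t + i + 1 = row \<nu> i + K)" for t
  proof -
    have "t = row \<nu> i + K - Suc i \<longleftrightarrow> t + i + 1 = row \<nu> i + K" if "i \<in> R" for i
      using RD(1)[OF that] by linarith
    then show ?thesis by auto
  qed
  have "?T \<subseteq> free_peaks (east_step K \<nu>) (free_vertex K \<mu> \<nu>) \<inter> {..<K + row lam 0}"
  proof
    fix t assume "t \<in> ?T"
    then obtain i where i: "i \<in> R" "t + i + 1 = row \<nu> i + K" using T by blast
    note RDi = RD[OF i(1)]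
    have "row \<nu> i \<le> row lam i" using \<nu> by (simp add: carrier_young_interval)
    also have "\<dots> \<le> row lam 0" using row_antimono[OF lam] by simp
    finally have "row \<nu> i \<le> row lam 0" .
    then have "t < K + row lam 0" using i by linarith
    moreover have "0 < t" using i(2) RDi by linarith
    moreover have "east_step K \<nu> (t - 1)"
      unfolding east_step_def
    proof
      assume "\<exists>j<K. t - 1 + j + 1 = row \<nu> j + K"
      then obtain j where j: "t + j = row \<nu> j + K" using \<open>0 < t\<close> by auto
      show False
      proof (cases "j \<le> i")
        case True
        then show False using j i(2) row_antimono[OF part, of j i] by linarith
      next
        case False
        then show False using j i(2) RDi(2) row_antimono[OF part, of "Suc i" j] by linarith
      qed
    qed
    moreover have "\<not> east_step K \<nu> t" using i RDi unfolding east_step_def by blast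
    moreover have "free_vertex K \<mu> \<nu> t"
      unfolding free_vertex_def using i RDi by (intro exI[of _ i]) linarith
    ultimately show "t \<in> free_peaks (east_step K \<nu>) (free_vertex K \<mu> \<nu>) \<inter> {..<K + row lam 0}"
      by (simp add: free_peaks_def)
  qed
  moreover have "east_step K \<nu>' t = flip (east_step K \<nu>) ?T t" for t
  proof -
    have rowR: "row \<nu>' i + 1 = row \<nu> i" if "i \<in> R" for i using row'[of i] RD(3)[OF that] that by simp
    have rownR: "row \<nu>' i = row \<nu> i" if "i \<notin> R" for i using row'[of i] that by simp
    have north': "\<not> east_step K \<nu>' t \<longleftrightarrow> Suc t \<in> ?T \<or> (\<exists>i<K. i \<notin> R \<and> t + i + 1 = row \<nu> i + K)"
    proof -
      have "i < K \<and> t + i + 1 = row \<nu>' i + K \<longleftrightarrow>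
          i \<in> R \<and> Suc t + i + 1 = row \<nu> i + K \<or> i < K \<and> i \<notin> R \<and> t + i + 1 = row \<nu> i + K" for i
        using rowR[of i] rownR[of i] RD(1)[of i] by (cases "i \<in> R") auto
      then show ?thesis unfolding east_step_def T by blast
    qed
    have "(\<exists>i<K. i \<notin> R \<and> t + i + 1 = row \<nu> i + K) \<longleftrightarrow> t \<notin> ?T \<and> \<not> east_step K \<nu> t"
      unfolding T east_step_def using inj RD(1) by blast
    then show ?thesis using north' unfolding flip_def by blast
  qed
  \<comment> \<open>Removing the last cell of row \<open>i\<close> affects only its own diagonal,
    whose vertex is the flipped one.\<close>
  moreover have "free_vertex K \<mu> \<nu>' t = free_vertex K \<mu> \<nu> t" if "t \<notin> ?T" for t
  proof -
    have "i + t < row \<nu>' i + K \<longleftrightarrow> i + t < row \<nu> i + K" for i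
      using row'[of i] that RD(3)[of i] unfolding T by (cases "i \<in> R") force+
    then show ?thesis by (simp add: free_vertex_def)
  qed
  ultimately show ?thesis unfolding flips_to_def by blast
qed

text \<open>The North step after the peak names the row \<open>i\<close>; the East step before it
  makes the row end in a corner, and freeness puts that corner outside \<open>\<mu>\<close>.\<close>

lemma free_peaks_from_rows:
  assumes \<nu>: "\<nu> \<in> carrier (young_interval \<mu> lam)" and \<mu>: "is_partition \<mu>"
  defines "K \<equiv> length lam"
  assumes T: "T \<subseteq> free_peaks (east_step K \<nu>) (free_vertex K \<mu> \<nu>)"
  obtains R where "R \<subseteq> removable_rows \<mu> \<nu>" "T = (\<lambda>i. row \<nu> i + K - Suc i) ` R"
proof -
  have part: "is_partition \<nu>" using \<nu> by (simp add: carrier_young_interval)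
  have "\<exists>i\<in>removable_rows \<mu> \<nu>. t = row \<nu> i + K - Suc i" if "t \<in> T" for t
  proof -
    have t: "0 < t" "east_step K \<nu> (t - 1)" "\<not> east_step K \<nu> t" "free_vertex K \<mu> \<nu> t"
      using T that by (auto simp: free_peaks_def)
    obtain i where i: "i < K" "t + i + 1 = row \<nu> i + K" using t(3) by (auto simp: east_step_def)
    obtain j where j: "row \<mu> j + K \<le> j + t" "j + t < row \<nu> j + K"
      using t(4) by (auto simp: free_vertex_def)
    \<comment> \<open>The cell witnessing freeness lies on the diagonal of the corner in row
      \<open>i\<close>. It cannot lie below the corner, since it belongs to \<open>\<nu>\<close>;
      and if \<open>\<mu>\<close> misses a cell weakly northwest of the corner, it misses the
      corner.\<close>
    have "row \<mu> i < row \<nu> i"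
    proof (cases "j \<le> i")
      case True
      then show ?thesis using row_antimono[OF \<mu>, of j i] i j by linarith
    next
      case False
      then show ?thesis using row_antimono[OF part, of i j] i j by linarith
    qed
    \<comment> \<open>Two equal consecutive rows would make step \<open>t - 1\<close> the North step
      of row \<open>Suc i\<close>.\<close>
    moreover have "row \<nu> (Suc i) \<noteq> row \<nu> i"
    proof
      assume eq: "row \<nu> (Suc i) = row \<nu> i"
      then have "Suc i < length \<nu>"
        using row_pos_iff[OF part] calculation by (metis gr_implies_not0 neq0_conv)
      then have "Suc i < K" using length_young_interval[OF \<nu>] by (simp add: K_def)
      moreover have "t - 1 + Suc i + 1 = row \<nu> (Suc i) + K" using eq i t(1) by simp
      ultimately show False using t(2) unfolding east_step_def by blast
    qed
    ultimately have "i \<in> removable_rows \<mu> \<nu>"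
      using row_antimono[OF part, of i "Suc i"] by (simp add: removable_rows_def)
    moreover have "t = row \<nu> i + K - Suc i" using i(2) by linarith
    ultimately show ?thesis by blast
  qed
  then show ?thesis
    using that[of "{i \<in> removable_rows \<mu> \<nu>. row \<nu> i + K - Suc i \<in> T}"] by blast
qed

lemma sum_rows_decrease:
  assumes "R \<noteq> {}" "R \<subseteq> removable_rows \<mu> \<nu>" "shrinks_to \<nu> R \<nu>'" "length \<nu> \<le> K"
  shows "(\<Sum>i<K. row \<nu>' i) < (\<Sum>i<K. row \<nu> i)"
proof (rule sum_strict_mono_ex1)
  obtain i where "i \<in> R" using assms(1) by blast
  then have "i < K" "row \<nu>' i < row \<nu> i"
    using assms removable_less_length[of i \<mu> \<nu>] by (auto simp: shrinks_to_def removable_rows_def)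
  then show "\<exists>i\<in>{..<K}. row \<nu>' i < row \<nu> i" by blast
qed (use assms(3) in \<open>auto simp: shrinks_to_def\<close>)

text \<open>The positions without an odd pair form a kernel: flips always create an odd pair from
  them, and suitable flips reach them from elsewhere. The number of cells is the decreasing
  measure.\<close>

lemma atniss_win_young_interval:
  assumes \<mu>: "is_partition \<mu>" and lam: "is_partition lam" and le: "\<mu> \<le>\<^sub>Y lam"
  defines "K \<equiv> length lam"
  shows "atniss_win (young_interval \<mu> lam) \<longleftrightarrow>
     odd_odd_peak (K + row lam 0) (east_step K lam) (free_vertex K \<mu> lam)"
proof -
  let ?L = "young_interval \<mu> lam" and ?M = "K + row lam 0"
  define G where "G = {\<nu>. \<not> odd_odd_peak ?M (east_step K \<nu>) (free_vertex K \<mu> \<nu>)}"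
  have "atniss_win ?L \<longleftrightarrow> \<top>\<^bsub>?L\<^esub> \<notin> G"
  proof (rule atniss_win_iff_not_kernel[where C = "carrier ?L" and m = "\<lambda>\<nu>. \<Sum>i<K. row \<nu> i"])
    fix x y assume x: "x \<in> carrier ?L" and "nontrivial_ungar_move ?L x y"
    then obtain R where R: "R \<noteq> {}" "R \<subseteq> removable_rows \<mu> x" "shrinks_to x R y"
      using nontrivial_ungar_move_young_interval[OF x] by blast
    show "y \<in> carrier ?L \<and> (\<Sum>i<K. row y i) < (\<Sum>i<K. row x i)"
      using shrinks_to_carrier[OF x R(2,3)] sum_rows_decrease[OF R] length_young_interval[OF x]
      by (simp add: K_def)
    show "y \<notin> G" if "x \<in> G"
      using flip_creates_odd_odd_peak[OF shrinks_to_flips_to[OF x lam R(2,3)]] R(1) that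
      by (simp add: G_def K_def)
  next
    show "\<top>\<^bsub>?L\<^esub> \<in> carrier ?L"
      using lam le by (simp add: top_young_interval carrier_young_interval young_le_row)
  next
    fix x assume x: "x \<in> carrier ?L" "x \<notin> G"
    then obtain T where T: "T \<noteq> {}" "T \<subseteq> free_peaks (east_step K x) (free_vertex K \<mu> x) \<inter> {..<?M}"
      and good: "\<And>e' fr'. flips_to ?M (east_step K x) (free_vertex K \<mu> x) T e' fr' \<Longrightarrow>
        \<not> odd_odd_peak ?M e' fr'"
      using exists_flip_removing_odd_odd_peaks[of ?M "east_step K x" "free_vertex K \<mu> x"]
      by (auto simp: G_def)
    obtain R where R: "R \<subseteq> removable_rows \<mu> x" "T = (\<lambda>i. row x i + K - Suc i) ` R"
      using free_peaks_from_rows[OF x(1) \<mu>] T(2) unfolding K_def by blast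
    obtain y where y: "shrinks_to x R y"
      using shrinks_to_exists[OF _ R(1)] x(1) by (auto simp: carrier_young_interval)
    have "y \<in> G"
      using good shrinks_to_flips_to[OF x(1) lam R(1) y] R(2) by (simp add: G_def K_def)
    moreover have "nontrivial_ungar_move ?L x y"
      using nontrivial_ungar_move_young_interval[OF x(1)] R T(1) y by blast
    ultimately show "\<exists>y. nontrivial_ungar_move ?L x y \<and> y \<in> G" by blast
  qed
  then show ?thesis by (simp add: top_young_interval[OF lam le] G_def)
qed

section \<open>Boundary paths\<close>

lemma boundary_path_nth:
  assumes "is_partition lam"
  shows "length (boundary_path lam) = length lam + row lam 0 \<and>
    (\<forall>t < length lam + row lam 0. boundary_path lam ! t = East \<longleftrightarrow> east_step (length lam) lam t)"
  using assms
proof (induction lam rule: boundary_path.induct)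
  case 1
  then show ?case by (simp add: row_def)
next
  case (2 a)
  then show ?case by (auto simp: row_def east_step_def nth_append less_Suc_eq)
next
  case (3 a b bs)
  let ?xs = "b # bs" and ?K = "length (b # bs)"
  have part: "is_partition ?xs" and ab: "b \<le> a"
    using "3.prems" by (auto simp: is_partition_def)
  have rows: "row (a # ?xs) 0 = a" "\<And>i. row (a # ?xs) (Suc i) = row ?xs i" "row ?xs 0 = b"
    by (auto simp: row_def)
  have IH: "length (boundary_path ?xs) = ?K + b"
    "\<And>t. t < ?K + b \<Longrightarrow> boundary_path ?xs ! t = East \<longleftrightarrow> east_step ?K ?xs t"
    using "3.IH"[OF part] rows(3) by auto
  \<comment> \<open>The new first row shifts the index of each old row and the box height by one, so
    old North steps keep their place; the new one is last.\<close>
  have east: "east_step (Suc ?K) (a # ?xs) t \<longleftrightarrow> t \<noteq> a + ?K \<and> east_step ?K ?xs t" for t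
  proof -
    have "(\<exists>i<Suc ?K. t + i + 1 = row (a # ?xs) i + Suc ?K) \<longleftrightarrow>
        t + 1 = a + Suc ?K \<or> (\<exists>i<?K. t + Suc i + 1 = row ?xs i + Suc ?K)"
      using rows by (subst Ex_less_Suc2) simp
    then show ?thesis by (simp add: east_step_def)
  qed
  \<comment> \<open>Beyond the path of the tail no row has a North step, so \<open>east_step\<close>
    yields East; these are the East steps added before the new North step.\<close>
  have high: "east_step ?K ?xs t" if "?K + b \<le> t" for t
  proof -
    have "t + i + 1 \<noteq> row ?xs i + ?K" for i
      using row_antimono[OF part, of 0 i] rows(3) that by simp
    then show ?thesis by (simp add: east_step_def)
  qed
  have "boundary_path (a # ?xs) ! t = East \<longleftrightarrow> east_step (Suc ?K) (a # ?xs) t"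
    if t: "t < Suc ?K + a" for t
  proof -
    consider "t < ?K + b" | "?K + b \<le> t" "t < ?K + a" | "t = ?K + a" using t by linarith
    then show ?thesis
    proof cases
      case 1
      then have "t \<noteq> a + ?K" using ab by simp
      then show ?thesis using 1 IH east by (simp add: nth_append)
    next
      case 2
      then have "boundary_path (a # ?xs) ! t = East" using IH(1) ab by (simp add: nth_append)
      then show ?thesis using 2 high[OF 2(1)] unfolding east by simp
    next
      case 3
      then have "boundary_path (a # ?xs) ! t = North" using IH(1) ab by (simp add: nth_append)
      then show ?thesis using 3 unfolding east by simp
    qed
  qed
  then show ?case using IH(1) ab rows(1) by simp
qed

text \<open>If every East step is free, the recursion counts all of them back to the start of the
  block, so it computes the parity of the block length.\<close>

lemma odd_east_run_word:
  assumes "\<And>t. t < length w \<Longrightarrow> e t \<longleftrightarrow> w ! t = East"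
    and "\<And>t. t < length w \<Longrightarrow> e t \<Longrightarrow> fr (Suc t)"
    and "t \<le> length w" "take t w = us @ replicate a East" "us = [] \<or> last us \<noteq> East"
  shows "odd_east_run e fr t \<longleftrightarrow> odd a"
  using assms(3,4)
proof (induction a arbitrary: t)
  case 0
  show ?case
  proof (cases t)
    case (Suc s)
    then have "us = take s w @ [w ! s]" using 0 by (simp add: take_Suc_conv_app_nth)
    then show ?thesis using 0 Suc assms(1)[of s] assms(5) by auto
  qed simp
next
  case (Suc a)
  have eq: "take t w = (us @ replicate a East) @ [East]"
    using Suc.prems(2) by (simp add: replicate_append_same)
  then obtain s where s: "t = Suc s" by (cases t) auto
  then have "take s w @ [w ! s] = (us @ replicate a East) @ [East]"
    using eq Suc.prems(1) by (simp add: take_Suc_conv_app_nth)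
  then have "take s w = us @ replicate a East" "w ! s = East" by auto
  then show ?case using Suc.IH[of s] Suc.prems(1) s assms(1,2)[of s] by simp
qed

lemma odd_north_run_word:
  assumes "\<And>t. t < length w \<Longrightarrow> e t \<longleftrightarrow> w ! t = East"
    and "\<And>t. t < length w \<Longrightarrow> \<not> e t \<Longrightarrow> fr t"
    and "t \<le> length w" "drop t w = replicate b North @ vs" "vs = [] \<or> hd vs \<noteq> North"
  shows "odd_north_run (length w) e fr t \<longleftrightarrow> odd b"
  using assms(3,4)
proof (induction b arbitrary: t)
  case 0
  show ?case
  proof (cases "t = length w")
    case False
    then have "w ! t \<noteq> North" using 0 assms(5) hd_drop_conv_nth[of t w] by auto
    then have "e t" using False 0 assms(1)[of t] by (cases "w ! t") auto
    then show ?thesis using False 0 by (simp add: odd_north_run_step)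
  qed simp
next
  case (Suc b)
  then have t: "t < length w" by (cases "t = length w") auto
  then have "w ! t # drop (Suc t) w = North # replicate b North @ vs"
    using Suc.prems(2) by (simp add: Cons_nth_drop_Suc)
  then have "w ! t = North" "drop (Suc t) w = replicate b North @ vs" by auto
  then show ?case using Suc.IH[of "Suc t"] t assms(1,2)[of t] by (simp add: odd_north_run_step)
qed

lemma split_trailing_run: "\<exists>us a. xs = us @ replicate a c \<and> (us = [] \<or> last us \<noteq> c)"
proof (induction xs rule: rev_induct)
  case Nil
  show ?case by (intro exI[of _ "[]"] exI[of _ 0]) simp
next
  case (snoc x xs)
  show ?case
  proof (cases "x = c")
    case True
    obtain us a where "xs = us @ replicate a c" "us = [] \<or> last us \<noteq> c" using snoc.IH by blast
    then show ?thesis using True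
      by (intro exI[of _ us] exI[of _ "Suc a"]) (simp add: replicate_append_same)
  next
    case False
    then show ?thesis by (intro exI[of _ "xs @ [x]"] exI[of _ 0]) simp
  qed
qed

lemma split_leading_run: "\<exists>a vs. xs = replicate a c @ vs \<and> (vs = [] \<or> hd vs \<noteq> c)"
proof (induction xs)
  case Nil
  show ?case by simp
next
  case (Cons x xs)
  show ?case
  proof (cases "x = c")
    case True
    obtain a vs where "xs = replicate a c @ vs" "vs = [] \<or> hd vs \<noteq> c" using Cons.IH by blast
    then show ?thesis using True by (intro exI[of _ "Suc a"] exI[of _ vs]) simp
  next
    case False
    then show ?thesis by (intro exI[of _ 0] exI[of _ "x # xs"]) simp
  qed
qed

text \<open>Cut the word at the peak vertex: the block of East steps ends the prefix and the block
  of North steps starts the suffix.\<close>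

lemma odd_odd_peak_word:
  assumes e: "\<And>t. t < length w \<Longrightarrow> e t \<longleftrightarrow> w ! t = East"
    and fr: "\<And>t. t < length w \<Longrightarrow> e t \<Longrightarrow> fr (Suc t)" "\<And>t. t < length w \<Longrightarrow> \<not> e t \<Longrightarrow> fr t"
  shows "odd_odd_peak (length w) e fr \<longleftrightarrow> has_odd_east_odd_north w"
proof
  assume "odd_odd_peak (length w) e fr"
  then obtain t where t: "t \<le> length w" "odd_east_run e fr t" "odd_north_run (length w) e fr t"
    unfolding odd_odd_peak_def by blast
  obtain us a where us: "take t w = us @ replicate a East" "us = [] \<or> last us \<noteq> East"
    using split_trailing_run[of "take t w" East] by blast
  obtain b vs where vs: "drop t w = replicate b North @ vs" "vs = [] \<or> hd vs \<noteq> North"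
    using split_leading_run[of "drop t w" North] by blast
  have odd: "odd a" "odd b"
    using odd_east_run_word[of w e fr, OF e fr(1) t(1) us]
      odd_north_run_word[of w e fr, OF e fr(2) t(1) vs] t
    by auto
  then have pos: "a > 0" "b > 0" by (auto simp: odd_pos)
  have "w = us @ replicate a East @ replicate b North @ vs"
    using us(1) vs(1) append_take_drop_id[of t w] by simp
  then show "has_odd_east_odd_north w"
    unfolding has_odd_east_odd_north_def is_block_def using odd pos us(2) vs(2)
    by (intro exI[of _ us] exI[of _ a] exI[of _ b] exI[of _ vs]) (simp add: hd_append)
next
  assume "has_odd_east_odd_north w"
  then obtain us a b vs where w: "w = us @ replicate a East @ replicate b North @ vs"
    and us: "us = [] \<or> last us \<noteq> East" and vs: "vs = [] \<or> hd vs \<noteq> North" and odd: "odd a" "odd b"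
    unfolding has_odd_east_odd_north_def is_block_def by blast
  let ?t = "length us + a"
  have t: "?t \<le> length w" "take ?t w = us @ replicate a East" "drop ?t w = replicate b North @ vs"
    using w by auto
  have "odd_east_run e fr ?t" "odd_north_run (length w) e fr ?t"
    using odd_east_run_word[of w e fr, OF e fr(1) t(1,2) us]
      odd_north_run_word[of w e fr, OF e fr(2) t(1,3) vs] odd
    by auto
  then show "odd_odd_peak (length w) e fr" using t(1) unfolding odd_odd_peak_def by blast
qed

section \<open>Consequences of the staircase bounds\<close>

lemma row_staircase: "row (staircase m) i = m - i"
  by (auto simp: row_def staircase_def rev_nth simp del: upt_Suc)

text \<open>Shows that some staircase contains \<open>\<mu>\<close>, so the \<open>LEAST\<close>
  defining \<open>n\<close> is attained.\<close>

lemma young_le_staircase: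
  assumes "is_partition \<mu>"
  shows "\<mu> \<le>\<^sub>Y staircase (length \<mu> + row \<mu> 0)"
  unfolding young_le_row
proof
  fix i
  show "row \<mu> i \<le> row (staircase (length \<mu> + row \<mu> 0)) i"
    using row_antimono[OF assms, of 0 i]
    by (cases "i < length \<mu>") (auto simp: row_staircase, simp add: row_def)
qed

text \<open>The two staircases separate the boundaries of \<open>\<mu>\<close> and
  \<open>lam\<close>, so every step of the path of \<open>lam\<close> is free. Odd pairs of free
  runs are then odd blocks of the word itself.\<close>

theorem theorem1p5:
  fixes \<mu> lam :: "nat list" and n :: nat
  assumes "is_partition \<mu>" and "is_partition lam" and "\<mu> \<le>\<^sub>Y lam"
    and "n = (LEAST m. \<mu> \<le>\<^sub>Y staircase m)"
    and "staircase (n + 1) \<le>\<^sub>Y lam"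
  shows "eeta_win (young_interval \<mu> lam) \<longleftrightarrow> \<not> has_odd_east_odd_north (boundary_path lam)"
proof -
  let ?K = "length lam" and ?w = "boundary_path lam"
  have "\<mu> \<le>\<^sub>Y staircase n"
    unfolding assms(4) using young_le_staircase[OF assms(1)] by (rule LeastI)
  then have upper: "row \<mu> i \<le> n - i" for i by (simp add: young_le_row row_staircase)
  have lower: "n + 1 - i \<le> row lam i" for i
    using assms(5) by (simp add: young_le_row row_staircase)
  have w: "length ?w = ?K + row lam 0"
    "\<And>t. t < length ?w \<Longrightarrow> east_step ?K lam t \<longleftrightarrow> ?w ! t = East"
    using boundary_path_nth[OF assms(2)] by auto
  have north: "free_vertex ?K \<mu> lam t" if t: "\<not> east_step ?K lam t" for t
  proof -
    obtain i where i: "i < ?K" "t + i + 1 = row lam i + ?K" using t by (auto simp: east_step_def)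
    \<comment> \<open>For \<open>i \<le> n\<close> the staircases differ by one cell in row
      \<open>i\<close>; for larger \<open>i\<close> the row of \<open>\<mu>\<close> is empty while
      that of \<open>lam\<close> is not. The free cell is the one left of the North step.\<close>
    have "row \<mu> i < row lam i"
      using upper[of i] lower[of i] row_pos_iff[OF assms(2), of i] i(1) by linarith
    then show ?thesis unfolding free_vertex_def using i(2) by (intro exI[of _ i]) linarith
  qed
  have east: "free_vertex ?K \<mu> lam (Suc t)" if t: "t < ?K + row lam 0" "east_step ?K lam t" for t
  proof -
    \<comment> \<open>The first row whose North step precedes step \<open>t\<close>. The row
      \<open>i\<close> just before it contains the cell directly above East step \<open>t\<close>,
      and this cell witnesses that \<open>Suc t\<close> is free.\<close>
    define I where "I = (LEAST i. row lam i + ?K < t + i + 1)"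
    have ex: "row lam ?K + ?K < t + ?K + 1" by (simp add: row_def)
    have I: "row lam I + ?K < t + I + 1" unfolding I_def using ex by (rule LeastI)
    have "I \<le> ?K" unfolding I_def using ex by (rule Least_le)
    obtain i where i: "I = Suc i" using I t(1) by (cases I) auto
    have "\<not> row lam i + ?K < t + i + 1"
      using not_less_Least[of i "\<lambda>i. row lam i + ?K < t + i + 1"] i by (simp add: I_def)
    moreover have "t + i + 1 \<noteq> row lam i + ?K"
      using t(2) \<open>I \<le> ?K\<close> i by (auto simp: east_step_def)
    \<comment> \<open>Here the index \<open>n + 1\<close> of the larger staircase matters:
      \<open>n - i = n + 1 - Suc i\<close>, so row \<open>i\<close> of \<open>\<mu>\<close> fits
      below row \<open>Suc i\<close> of \<open>lam\<close>.\<close>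
    moreover have "row \<mu> i \<le> row lam I" using upper[of i] lower[of I] i by simp
    ultimately show ?thesis
      unfolding free_vertex_def using I i by (intro exI[of _ i]) linarith
  qed
  have "odd_odd_peak (length ?w) (east_step ?K lam) (free_vertex ?K \<mu> lam) \<longleftrightarrow>
      has_odd_east_odd_north ?w"
    using w east north by (intro odd_odd_peak_word) auto
  then show ?thesis
    unfolding eeta_win_def atniss_win_young_interval[OF assms(1-3)] w(1) by simp
qed

end
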